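(* Every threshold hypergraph is Laplacian $r$-integral for some $r\in\mathbb{Q}$; that is, for every threshold hypergraph $G$ there exists $r\in\mathbb{Q}$ such that every eigenvalue of $L_G$ is of the form $rp$ with $p\in\mathbb{Z}$.
   Context: A (finite) hypergraph $G=(V,E)$ consists of a nonempty finite vertex set $V$ and a set $E$ of subsets of $V$ (hyperedges), with $|e|\ge 2$ for all $e\in E$. For $v\in V$ let $E_v=\{e\in E: v\in e\}$. The Laplacian $L_G:\mathbb{R}^V\to\mathbb{R}^V$ is $$(L_Gf)(v)=\sum_{e\in E_v}\frac{1}{|e|-1}\sum_{u\in e}\bigl(f(v)-f(u)\bigr),\qquad v\in V.$$ A hypergraph $G$ is Laplacian $r$-integral if all eigenvalues of $L_G$ are integer multiples of the real number $r$. For a positive integer $k$, applying $k$-domination to a hypergraph $(V,E)$ means adding a set $S$ of $k$ new vertices ($S\cap V=\emptyset$), producing the hypergraph with vertex set $V\cup S$ and hyperedge set $E\cup\{S\cup\{v\}: v\in V\}$. Adding an isolated vertex means adding one new vertex without changing the hyperedge set. A threshold hypergraph is a hypergraph obtained from a single vertex by repeatedly (any number of times, in any order) adding an isolated vertex or applying $k$-domination for some positive integer $k$ ($k$ may vary from step to step). *)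

theory Defs
  imports "HOL-Analysis.Analysis"
begin

definition hypergraph :: "'a set \<Rightarrow> 'a set set \<Rightarrow> bool" where
  "hypergraph V E \<longleftrightarrow>
     finite V \<and> V \<noteq> {} \<and> (\<forall>e\<in>E. e \<subseteq> V \<and> card e \<ge> 2)"

definition incident_edges :: "'a set set \<Rightarrow> 'a \<Rightarrow> 'a set set" where
  "incident_edges E v = {e \<in> E. v \<in> e}"

text \<open>
  A real-valued function on a vertex set \<open>V\<close> is an element of \<open>V \<rightarrow>\<^sub>E UNIV\<close>, that is, a
  function of type \<open>'a \<Rightarrow> real\<close> that takes the value \<open>undefined\<close> outside \<open>V\<close>. This makes
  equality of such functions the same as equality on \<open>V\<close>.
\<close>

definition laplacian :: "'a set \<Rightarrow> 'a set set \<Rightarrow> ('a \<Rightarrow> real) \<Rightarrow> 'a \<Rightarrow> real" where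
  "laplacian V E f =
     (\<lambda>v\<in>V. \<Sum>e\<in>incident_edges E v. 1 / (real (card e) - 1) * (\<Sum>u\<in>e. f v - f u))"

definition is_eigenvalue :: "'a set \<Rightarrow> (('a \<Rightarrow> real) \<Rightarrow> 'a \<Rightarrow> real) \<Rightarrow> real \<Rightarrow> bool" where
  "is_eigenvalue V L c \<longleftrightarrow>
     (\<exists>f \<in> V \<rightarrow>\<^sub>E UNIV. f \<noteq> (\<lambda>v\<in>V. 0) \<and> L f = (\<lambda>v\<in>V. c * f v))"

definition laplacian_integral :: "real \<Rightarrow> 'a set \<Rightarrow> 'a set set \<Rightarrow> bool" where
  "laplacian_integral r V E \<longleftrightarrow>
     (\<forall>c. is_eigenvalue V (laplacian V E) c \<longrightarrow> (\<exists>p::int. c = r * of_int p))"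

inductive threshold_hypergraph :: "'a set \<Rightarrow> 'a set set \<Rightarrow> bool" where
  single_vertex: "threshold_hypergraph {v} {}"
| isolated_vertex:
    "threshold_hypergraph V E \<Longrightarrow> w \<notin> V \<Longrightarrow> threshold_hypergraph (insert w V) E"
| domination:
    "threshold_hypergraph V E \<Longrightarrow> k > 0 \<Longrightarrow> finite S \<Longrightarrow> card S = k \<Longrightarrow> S \<inter> V = {} \<Longrightarrow>
     threshold_hypergraph (V \<union> S) (E \<union> {S \<union> {v} | v. v \<in> V})"

lemma threshold_hypergraph_imp_hypergraph:
  assumes "threshold_hypergraph V E"
  shows "hypergraph V E"
  using assms
proof (induction rule: threshold_hypergraph.induct)
  case (domination V E k S)
  have "card (S \<union> {v}) \<ge> 2" if "v \<in> V" for v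
  proof -
    have "v \<notin> S" using that domination.hyps by blast
    then show ?thesis using domination.hyps by simp
  qed
  then show ?case using domination by (auto simp: hypergraph_def)
qed (auto simp: hypergraph_def)

end

theory Submission
  imports Defs
begin

text \<open>
  The proof follows the spectrum along the construction of a threshold hypergraph and shows that
  a common denominator survives each step.

  An isolated vertex contributes only the eigenvalue \<open>0\<close>: an eigenvector for \<open>c \<noteq> 0\<close> vanishes
  there, so it restricts to an eigenvector of the old hypergraph.

  For domination by a set \<open>S\<close> of \<open>k\<close> vertices, let \<open>n\<close> be the number of old vertices and \<open>f\<close> an
  eigenvector of the new Laplacian with eigenvalue \<open>c\<close>. If \<open>f\<close> takes different values at two
  vertices of \<open>S\<close>, comparing the eigenvalue equations there gives \<open>c = n (k + 1) / k\<close>. Otherwise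
  \<open>f\<close> has a constant value \<open>a\<close> on \<open>S\<close>, and on the old vertices the equation reads
  \<open>L f + f - a = c f\<close>. Since \<open>L\<close> annihilates constants, for \<open>c \<noteq> 1\<close> the shifted function
  \<open>f - a / (1 - c)\<close> satisfies \<open>L g = (c - 1) g\<close>, so either \<open>c - 1\<close> is an eigenvalue of \<open>L\<close> or
  \<open>f\<close> is constant on the old vertices. In the latter case, two scalar equations leave only
  \<open>c = 0\<close> and \<open>c = 1 + n / k\<close>. Hence \<open>c\<close> is \<open>0\<close>, \<open>1\<close>, \<open>n (k + 1) / k\<close>, \<open>1 + n / k\<close>, or one plus
  an old eigenvalue, and a denominator \<open>N\<close> of the old spectrum can be replaced by \<open>N k\<close>.
\<close>

section \<open>Functions on the vertex set\<close>

lemma laplacian_cong: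
  assumes "hypergraph V E" "\<And>v. v \<in> V \<Longrightarrow> f v = g v"
  shows "laplacian V E f = laplacian V E g"
proof -
  have "f u = g u" if "u \<in> e" "e \<in> incident_edges E v" for u v e
    using assms that by (auto simp: hypergraph_def incident_edges_def)
  then show ?thesis
    using assms(2) unfolding laplacian_def
    by (intro restrict_ext sum.cong refl arg_cong2[where f = "(*)"]) auto
qed

lemma laplacian_diff_const:
  "laplacian V E (\<lambda>v. f v - m) = laplacian V E f"
  by (simp add: laplacian_def)

text \<open>
  Eigenvectors can be sought among all functions, because the Laplacian sees only the values
  on the vertex set; this frees later arguments from restricting shifted functions.
\<close>

lemma is_eigenvalue_laplacian_iff:
  assumes "hypergraph V E"
  shows "is_eigenvalue V (laplacian V E) c \<longleftrightarrow>
    (\<exists>f. (\<exists>v\<in>V. f v \<noteq> 0) \<and> (\<forall>v\<in>V. laplacian V E f v = c * f v))"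
proof
  assume "is_eigenvalue V (laplacian V E) c"
  then obtain f where f: "f \<in> V \<rightarrow>\<^sub>E UNIV" "f \<noteq> (\<lambda>v\<in>V. 0)"
    "laplacian V E f = (\<lambda>v\<in>V. c * f v)"
    unfolding is_eigenvalue_def by blast
  from f(1,2) have "\<exists>v\<in>V. f v \<noteq> 0"
    by (metis PiE_restrict restrict_ext)
  then show "\<exists>f. (\<exists>v\<in>V. f v \<noteq> 0) \<and> (\<forall>v\<in>V. laplacian V E f v = c * f v)"
    using f(3) by auto
next
  assume "\<exists>f. (\<exists>v\<in>V. f v \<noteq> 0) \<and> (\<forall>v\<in>V. laplacian V E f v = c * f v)"
  then obtain f w where f: "w \<in> V" "f w \<noteq> 0" "\<forall>v\<in>V. laplacian V E f v = c * f v"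
    by blast
  have "laplacian V E (restrict f V) = laplacian V E f"
    using assms by (rule laplacian_cong) simp
  also have "\<dots> = (\<lambda>v\<in>V. c * restrict f V v)"
    using f(3) by (auto simp: laplacian_def restrict_def)
  finally have "laplacian V E (restrict f V) = (\<lambda>v\<in>V. c * restrict f V v)" .
  moreover have "restrict f V \<noteq> (\<lambda>v\<in>V. 0)"
    using f(1,2) by (metis restrict_apply')
  ultimately show "is_eigenvalue V (laplacian V E) c"
    unfolding is_eigenvalue_def by (intro bexI[where x = "restrict f V"]) auto
qed

section \<open>The spectrum under isolated vertices and domination\<close>

lemma eigenvalue_isolated_vertex:
  assumes hyp: "hypergraph V E" and w: "w \<notin> V"
    and eig: "is_eigenvalue (insert w V) (laplacian (insert w V) E) c" and "c \<noteq> 0"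
  shows "is_eigenvalue V (laplacian V E) c"
proof -
  have "hypergraph (insert w V) E"
    using hyp by (auto simp: hypergraph_def)
  from eig[unfolded is_eigenvalue_laplacian_iff[OF this]] obtain f
    where f: "\<exists>v\<in>insert w V. f v \<noteq> 0"
      "\<And>v. v \<in> insert w V \<Longrightarrow> laplacian (insert w V) E f v = c * f v" by blast
  have "incident_edges E w = {}"
    using hyp w by (auto simp: hypergraph_def incident_edges_def)
  then have "f w = 0"
    using f(2)[of w] \<open>c \<noteq> 0\<close> by (simp add: laplacian_def)
  moreover have "laplacian V E f v = c * f v" if "v \<in> V" for v
    using f(2)[of v] that by (simp add: laplacian_def)
  ultimately show ?thesis
    using f(1) unfolding is_eigenvalue_laplacian_iff[OF hyp] by auto
qed

text \<open>
  An old vertex lies in exactly one new edge, of size \<open>k + 1\<close>, so the weight \<open>1 / k\<close> turns its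
  contribution into the difference from the mean over \<open>S\<close>.
\<close>

lemma laplacian_domination_old_vertex:
  fixes f :: "'a \<Rightarrow> real"
  assumes hyp: "hypergraph V E" and S: "finite S" "S \<noteq> {}" "S \<inter> V = {}" and v: "v \<in> V"
  shows "laplacian (V \<union> S) (E \<union> {S \<union> {v} | v. v \<in> V}) f v
    = laplacian V E f v + f v - (\<Sum>s\<in>S. f s) / card S"
proof -
  have "finite E"
    using hyp by (intro finite_subset[of E "Pow V"]) (auto simp: hypergraph_def)
  have inc: "incident_edges (E \<union> {S \<union> {v} | v. v \<in> V}) v = insert (insert v S) (incident_edges E v)"
    using S v by (auto simp: incident_edges_def)
  have new: "insert v S \<notin> incident_edges E v"
    using S hyp by (fastforce simp: hypergraph_def incident_edges_def)
  have "v \<notin> S"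
    using S v by auto
  then have "laplacian (V \<union> S) (E \<union> {S \<union> {v} | v. v \<in> V}) f v
    = laplacian V E f v + (\<Sum>s\<in>S. f v - f s) / card S"
    using v S \<open>finite E\<close> new
    by (simp add: laplacian_def inc[simplified] incident_edges_def[of E])
  also have "(\<Sum>s\<in>S. f v - f s) / card S = f v - (\<Sum>s\<in>S. f s) / card S"
    using S by (simp add: sum_subtractf diff_divide_distrib)
  finally show ?thesis by simp
qed

lemma laplacian_domination_new_vertex:
  fixes f :: "'a \<Rightarrow> real"
  assumes hyp: "hypergraph V E" and S: "finite S" "S \<inter> V = {}" and s: "s \<in> S"
  shows "laplacian (V \<union> S) (E \<union> {S \<union> {v} | v. v \<in> V}) f s
    = (card V * (card S + 1) * f s - (\<Sum>v\<in>V. f v) - card V * (\<Sum>t\<in>S. f t)) / card S"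
proof -
  have inc: "incident_edges (E \<union> {S \<union> {v} | v. v \<in> V}) s = (\<lambda>v. insert v S) ` V"
    using S s hyp by (auto simp: incident_edges_def hypergraph_def)
  have inj: "inj_on (\<lambda>v. insert v S) V"
    using S by (auto intro!: inj_onI)
  have "laplacian (V \<union> S) (E \<union> {S \<union> {v} | v. v \<in> V}) f s
    = (\<Sum>v\<in>V. 1 / (real (card (insert v S)) - 1) * (\<Sum>u\<in>insert v S. f s - f u))"
    using s by (simp add: laplacian_def inc[simplified] sum.reindex[OF inj])
  also have "\<dots> = (\<Sum>v\<in>V. ((card S + 1) * f s - f v - (\<Sum>t\<in>S. f t)) / card S)"
  proof (rule sum.cong)
    fix v assume "v \<in> V"
    then have "v \<notin> S" using S by auto
    then show "1 / (real (card (insert v S)) - 1) * (\<Sum>u\<in>insert v S. f s - f u)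
      = ((card S + 1) * f s - f v - (\<Sum>t\<in>S. f t)) / card S"
      using S by (simp add: sum_subtractf algebra_simps diff_divide_distrib add_divide_distrib)
  qed simp
  also have "\<dots> = (card V * (card S + 1) * f s - (\<Sum>v\<in>V. f v) - card V * (\<Sum>t\<in>S. f t)) / card S"
    by (simp only: sum_divide_distrib[symmetric] sum_subtractf sum_constant of_nat_mult of_nat_add of_nat_1 mult.assoc)
  finally show ?thesis .
qed

text \<open>
  The case \<open>c = 1\<close> is set aside because the shift \<open>a / (1 - c)\<close> that reduces the inhomogeneous
  equation \<open>L f + f - a = c f\<close> to an eigenvalue equation for \<open>L\<close> does not exist there.
\<close>

lemma eigenvalue_domination:
  assumes hyp: "hypergraph V E" and S: "finite S" "S \<noteq> {}" "S \<inter> V = {}"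
    and eig: "is_eigenvalue (V \<union> S) (laplacian (V \<union> S) (E \<union> {S \<union> {v} | v. v \<in> V})) c"
  shows "c = 0 \<or> c = 1 \<or> c = card V * (card S + 1) / card S \<or> c = 1 + card V / card S \<or>
    is_eigenvalue V (laplacian V E) (c - 1)"
proof -
  define n k where "n = real (card V)" and "k = real (card S)"
  have "k > 0"
    using S by (simp add: k_def card_gt_0_iff)
  have "card (insert v S) \<ge> 2" if "v \<in> V" for v
  proof -
    have "v \<notin> S" using that S by auto
    moreover have "card S > 0" using S by (simp add: card_gt_0_iff)
    ultimately show ?thesis using S by simp
  qed
  then have hyp': "hypergraph (V \<union> S) (E \<union> {S \<union> {v} | v. v \<in> V})"
    using hyp S by (auto simp: hypergraph_def)
  from eig[unfolded is_eigenvalue_laplacian_iff[OF hyp']] obtain f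
    where nz: "\<exists>v\<in>V \<union> S. f v \<noteq> 0"
      and ev: "\<And>v. v \<in> V \<union> S \<Longrightarrow>
        laplacian (V \<union> S) (E \<union> {S \<union> {v} | v. v \<in> V}) f v = c * f v" by blast
  have old: "laplacian V E f v + f v - (\<Sum>s\<in>S. f s) / k = c * f v" if "v \<in> V" for v
    using ev[of v] that laplacian_domination_old_vertex[OF hyp S that, of f]
    by (simp add: k_def)
  have new: "(n * (k + 1) * f s - (\<Sum>v\<in>V. f v) - n * (\<Sum>t\<in>S. f t)) / k = c * f s"
    if "s \<in> S" for s
    using ev[of s] that laplacian_domination_new_vertex[OF hyp S(1,3) that, of f]
    by (simp add: n_def k_def algebra_simps)
  obtain s where s: "s \<in> S" using S by auto
  define a where "a = f s"
  show ?thesis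
  proof (cases "\<forall>t\<in>S. f t = a")
    case False
    then obtain t where t: "t \<in> S" "f t \<noteq> f s" by (auto simp: a_def)
    have "n * (k + 1) / k * (f t - f s) = c * (f t - f s)"
      unfolding right_diff_distrib new[OF t(1), symmetric] new[OF s, symmetric]
      by (simp add: diff_divide_distrib)
    then have "c = n * (k + 1) / k" using t(2) by (metis mult_right_cancel right_minus_eq)
    then show ?thesis unfolding n_def k_def of_nat_mult of_nat_add of_nat_1 by blast
  next
    case True
    then have sumS: "(\<Sum>t\<in>S. f t) = k * a" by (simp add: k_def)
    have old': "laplacian V E f v = (c - 1) * f v + a" if "v \<in> V" for v
      using old[OF that] \<open>k > 0\<close> by (simp add: sumS algebra_simps)
    show ?thesis
    proof (cases "c = 1")
      case False
      define m where "m = a / (1 - c)"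
      have m: "a = (1 - c) * m" using False by (simp add: m_def)
      have g: "laplacian V E (\<lambda>v. f v - m) v = (c - 1) * (f v - m)" if "v \<in> V" for v
        using old'[OF that] by (simp add: laplacian_diff_const m algebra_simps)
      show ?thesis
      proof (cases "\<forall>v\<in>V. f v = m")
        case False
        then have "\<exists>v\<in>V. f v - m \<noteq> 0" by auto
        then have "is_eigenvalue V (laplacian V E) (c - 1)"
          unfolding is_eigenvalue_laplacian_iff[OF hyp] using g
          by (intro exI[of _ "\<lambda>v. f v - m"]) simp
        then show ?thesis by simp
      next
        case const: True
        then have "(\<Sum>v\<in>V. f v) = n * m" by (simp add: n_def)
        then have "n * (a - m) = c * a * k"
          using new[OF s] \<open>k > 0\<close> by (simp add: sumS a_def[symmetric] field_simps)
        then have eq: "c * m * n + c * (1 - c) * m * k = 0"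
          unfolding m by (simp add: algebra_simps)
        \<comment> \<open>If \<open>m\<close> were \<open>0\<close>, then so would \<open>a\<close>, and \<open>f\<close> would vanish.\<close>
        have "m \<noteq> 0" using nz const True m by auto
        moreover have "m * (c * (n + (1 - c) * k)) = 0"
          using eq by (simp add: algebra_simps)
        ultimately have "c = 0 \<or> n + (1 - c) * k = 0" by simp
        then have "c = 0 \<or> c = 1 + n / k"
          using \<open>k > 0\<close> by (auto simp: field_simps)
        then show ?thesis by (auto simp: n_def k_def)
      qed
    qed simp
  qed
qed

section \<open>Common denominators\<close>

lemma of_int_div_nat_eq_multiple:
  assumes "N > 0" "k > 0"
  shows "of_int p / real N = 1 / real (N * k) * of_int (p * int k)"
    and "of_int p / real k = 1 / real (N * k) * of_int (p * int N)"
  using assms by (simp_all add: field_simps)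

text \<open>
  Restricting \<open>r\<close> to reciprocals of positive integers makes the induction work: every integer is
  then a multiple of \<open>r\<close>, and two such \<open>r\<close> have a common refinement.
\<close>

lemma threshold_hypergraph_spectrum_common_denominator:
  assumes "threshold_hypergraph V E"
  shows "\<exists>N::nat. N > 0 \<and> laplacian_integral (1 / real N) V E"
  using assms
proof (induction rule: threshold_hypergraph.induct)
  case (single_vertex v)
  have "c = 0" if c: "is_eigenvalue {v} (laplacian {v} {}) c" for c
  proof -
    have "hypergraph {v} {}" by (simp add: hypergraph_def)
    from c[unfolded is_eigenvalue_laplacian_iff[OF this]] show ?thesis
      by (auto simp: laplacian_def incident_edges_def)
  qed
  then have "laplacian_integral (1 / real 1) {v} {}"
    unfolding laplacian_integral_def by (auto intro: exI[of _ 0])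
  then show ?case by (intro exI[of _ 1]) simp
next
  case (isolated_vertex V E w)
  note hyp = threshold_hypergraph_imp_hypergraph[OF isolated_vertex.hyps(1)]
  from isolated_vertex.IH obtain N where N: "N > 0" "laplacian_integral (1 / real N) V E"
    by blast
  have "\<exists>p::int. c = 1 / real N * of_int p"
    if "is_eigenvalue (insert w V) (laplacian (insert w V) E) c" for c
  proof (cases "c = 0")
    case True
    then show ?thesis by (intro exI[of _ 0]) simp
  next
    case False
    then show ?thesis
      using eigenvalue_isolated_vertex[OF hyp isolated_vertex.hyps(2) that] N(2)
      unfolding laplacian_integral_def by blast
  qed
  with N(1) show ?case unfolding laplacian_integral_def by blast
next
  case (domination V E k S)
  note hyp = threshold_hypergraph_imp_hypergraph[OF domination.hyps(1)]
  from domination.IH obtain N where N: "N > 0" "laplacian_integral (1 / real N) V E"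
    by blast
  have k: "k > 0" "card S = k" and S: "finite S" "S \<noteq> {}" "S \<inter> V = {}"
    using domination.hyps by auto
  have "\<exists>p::int. c = 1 / real (N * k) * of_int p"
    if eig: "is_eigenvalue (V \<union> S) (laplacian (V \<union> S) (E \<union> {S \<union> {v} | v. v \<in> V})) c" for c
  proof -
    have "(\<exists>p::int. c = of_int p / real k) \<or> (\<exists>p::int. c = of_int p / real N)"
      using eigenvalue_domination[OF hyp S eig]
    proof (elim disjE)
      assume "c = 0"
      then have "c = of_int 0 / real k" by simp
      then show ?thesis by blast
    next
      assume "c = 1"
      then have "c = of_int (int k) / real k" using k by simp
      then show ?thesis by blast
    next
      assume "c = card V * (card S + 1) / card S"
      then have "c = of_int (int (card V * (k + 1))) / real k" using k by simp
      then show ?thesis by blast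
    next
      assume "c = 1 + card V / card S"
      then have "c = of_int (int (k + card V)) / real k" using k by (simp add: field_simps)
      then show ?thesis by blast
    next
      assume "is_eigenvalue V (laplacian V E) (c - 1)"
      then obtain p :: int where "c - 1 = 1 / real N * of_int p"
        using N(2) unfolding laplacian_integral_def by blast
      then have "c = of_int (p + int N) / real N" using N(1) by (simp add: field_simps)
      then show ?thesis by blast
    qed
    then show ?thesis
      using of_int_div_nat_eq_multiple[OF N(1) k(1)] by metis
  qed
  then have "laplacian_integral (1 / real (N * k)) (V \<union> S) (E \<union> {S \<union> {v} | v. v \<in> V})"
    unfolding laplacian_integral_def by blast
  moreover have "N * k > 0" using N(1) k(1) by simp
  ultimately show ?case by blast
qed

theorem proposition3p1:
  fixes V :: "'a set" and E :: "'a set set"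
  assumes "threshold_hypergraph V E"
  shows "\<exists>r\<in>\<rat>. laplacian_integral r V E"
proof -
  obtain N where "laplacian_integral (1 / real N) V E"
    using threshold_hypergraph_spectrum_common_denominator[OF assms] by blast
  moreover have "1 / real N \<in> \<rat>" by simp
  ultimately show ?thesis by blast
qed

end
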